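(* For every integer $m\geq 1$ there is a constant $C(m)>0$, depending only on $m$, with the following property. Let $K>0$ and let $F:D(0,1)\subset\mathbb{C}^m\longrightarrow\mathbb{C}^m$ be a Wu $K$-mapping, i.e. a holomorphic map satisfying $\|F'(z)\|\leq K\,|\det(F'(z))|^{1/m}$ for all $z\in D(0,1)$, normalised so that $|\det(F'(0))|=1$. Then $F$ covers a schlicht disk of radius at least $C(m)/K^{\frac{3}{2}m-\frac{1}{2}}$.
   Context: $D(0,1)=\{z\in\mathbb{C}^m:\ \max_{1\le j\le m}|z_j|<1\}$ is the open unit polydisk. For $z\in D(0,1)$, $F'(z)$ is the complex $m\times m$ Jacobian matrix of $F$ at $z$, and $\|A\|$ denotes the operator norm of a matrix $A$ with respect to the Euclidean norm $|w|=\sqrt{|w_1|^2+\dots+|w_m|^2}$ on $\mathbb{C}^m$. The map $F$ is said to cover a schlicht disk of radius $R$ if there is a subdomain (non-empty connected open subset) $\Omega\subset D(0,1)$ on which $F$ is one to one and whose image $F(\Omega)$ contains a Euclidean ball $B_R(w_0)=\{w\in\mathbb{C}^m:\ |w-w_0|<R\}$ for some $w_0\in\mathbb{C}^m$. *)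

theory Defs
  imports "HOL-Complex_Analysis.Complex_Analysis"
begin

text \<open>
  The space of \<open>m\<close>-tuples of complex numbers is \<open>complex ^ 'm\<close> with \<open>m = CARD('m)\<close>;
  its library norm is the Euclidean norm.
\<close>

definition unit_polydisk :: "(complex ^ 'm) set" where
  "unit_polydisk = {z. \<forall>j. norm (z $ j) < 1}"

text \<open>
  \<open>A *v h\<close> is complex linear in \<open>h\<close>, so on an open set this is complex Frechet
  differentiability at every point.
\<close>

definition holomorphic_map_on ::
    "(complex ^ 'n \<Rightarrow> complex ^ 'm) \<Rightarrow> (complex ^ 'n) set \<Rightarrow> bool" where
  "holomorphic_map_on F S \<longleftrightarrow>
     (\<forall>z\<in>S. \<exists>A :: complex ^ 'n ^ 'm. (F has_derivative (\<lambda>h. A *v h)) (at z))"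

text \<open>
  Since \<open>axis j t\<close> is \<open>t\<close> times the \<open>j\<close>-th unit vector, the entry in row \<open>i\<close> and column \<open>j\<close>
  is the partial derivative of the \<open>i\<close>-th component with respect to \<open>z\<^sub>j\<close>.
\<close>

definition complex_jacobian ::
    "(complex ^ 'n \<Rightarrow> complex ^ 'm) \<Rightarrow> complex ^ 'n \<Rightarrow> complex ^ 'n ^ 'm" where
  "complex_jacobian F z = (\<chi> i j. deriv (\<lambda>t. F (z + axis j t) $ i) 0)"

lemma complex_jacobian_eq:
  fixes F :: "complex ^ 'n \<Rightarrow> complex ^ 'm" and A :: "complex ^ 'n ^ 'm"
  assumes "(F has_derivative (\<lambda>h. A *v h)) (at z)"
  shows "complex_jacobian F z = A"
proof -
  have "((\<lambda>t. F (z + axis j t) $ i) has_field_derivative A $ i $ j) (at 0)" for i j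
  proof -
    have "bounded_linear (\<lambda>t::complex. axis j t :: complex ^ 'n)"
      by (intro linear_conv_bounded_linear[THEN iffD1] linearI)
        (auto simp: axis_def vec_eq_iff)
    then have "((\<lambda>t. z + axis j t) has_derivative (\<lambda>t. axis j t)) (at 0)"
      by (auto intro!: derivative_eq_intros bounded_linear_imp_has_derivative)
    moreover have "(F has_derivative (\<lambda>h. A *v h)) (at (z + axis j 0))"
      using assms by (simp add: axis_def flip: zero_vec_def)
    ultimately have "(F \<circ> (\<lambda>t. z + axis j t) has_derivative (\<lambda>h. A *v h) \<circ> (\<lambda>t. axis j t)) (at 0)"
      by (rule diff_chain_at)
    then have "((\<lambda>t. F (z + axis j t) $ i) has_derivative (\<lambda>t. (A *v axis j t) $ i)) (at 0)"
      unfolding o_def by (rule bounded_linear.has_derivative[OF bounded_linear_vec_nth])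
    moreover have "(A *v axis j t) $ i = A $ i $ j * t" for t
      by (simp add: matrix_vector_mult_def axis_def if_distrib cong: if_cong)
    ultimately show ?thesis
      by (simp add: has_field_derivative_def)
  qed
  then show ?thesis
    by (simp add: complex_jacobian_def vec_eq_iff DERIV_imp_deriv)
qed

definition Wu_mapping :: "real \<Rightarrow> (complex ^ 'm \<Rightarrow> complex ^ 'm) \<Rightarrow> bool" where
  "Wu_mapping K F \<longleftrightarrow>
     holomorphic_map_on F unit_polydisk \<and>
     (\<forall>z\<in>unit_polydisk.
        onorm (\<lambda>v. complex_jacobian F z *v v)
          \<le> K * norm (det (complex_jacobian F z)) powr (1 / real CARD('m)))"

definition covers_schlicht_disk :: "(complex ^ 'm \<Rightarrow> complex ^ 'm) \<Rightarrow> real \<Rightarrow> bool" where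
  "covers_schlicht_disk F R \<longleftrightarrow>
     (\<exists>\<Omega> w\<^sub>0. \<Omega> \<noteq> {} \<and> open \<Omega> \<and> connected \<Omega> \<and> \<Omega> \<subseteq> unit_polydisk \<and>
        inj_on F \<Omega> \<and> ball w\<^sub>0 R \<subseteq> F ` \<Omega>)"

end

theory Submission
  imports Defs
begin

text \<open>
  Put \<open>d z = norm (det (F' z))\<close>. As in the proof of Bloch's theorem, maximise
  \<open>(1/2 - norm z) ^ m * d z\<close> over \<open>cball 0 (1/2)\<close>, at \<open>z0\<close> say, and put \<open>t = 1/2 - norm z0\<close>
  and \<open>D = d z0\<close>. Then \<open>d \<le> 2 ^ m * D\<close> on \<open>ball z0 (t/2)\<close>, so by the Schwarz lemma on complex
  lines \<open>d \<ge> D/2\<close> on a ball around \<open>z0\<close> of radius \<open>\<rho> = t / 2 ^ (m + 4)\<close>, which does not involve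
  \<open>K\<close>. On that ball Cramer's rule and the Wu condition bound the inverse of \<open>F'\<close> by
  a multiple \<open>M\<close> of \<open>K ^ (m - 1) / root m D\<close>, and a local diffeomorphism whose inverse derivative
  is bounded by \<open>M\<close> on a ball of radius \<open>\<rho>\<close> covers a schlicht ball of radius \<open>\<rho> / M\<close>. Since
  \<open>t * root m D \<ge> 1/2\<close>, this radius is at least a constant over \<open>K ^ (m - 1)\<close>; as \<open>K\<close> is bounded
  below, this is stronger than the asserted power of \<open>K\<close>.
\<close>

section \<open>Schlicht balls of local diffeomorphisms\<close>

text \<open>Two distinct points near \<open>K\<close> with equal images would form a pair close to
  \<open>K \<times> K\<close>. Near \<open>K \<times> K\<close> every pair is either separated by
  \<open>f\<close> or contained in some \<open>U x \<times> U x\<close>, where \<open>f\<close> is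
  injective; compactness makes this uniform.\<close>

lemma inj_on_open_neighbourhood:
  fixes f :: "'a::metric_space \<Rightarrow> 'b::t2_space"
  assumes "compact K" "open B" "K \<subseteq> B" "continuous_on B f" "inj_on f K"
    and loc: "\<And>x. x \<in> K \<Longrightarrow> \<exists>U. open U \<and> x \<in> U \<and> inj_on f U"
  obtains N where "open N" "K \<subseteq> N" "N \<subseteq> B" "inj_on f N"
proof -
  obtain U where U: "\<And>x. x \<in> K \<Longrightarrow> open (U x)" "\<And>x. x \<in> K \<Longrightarrow> x \<in> U x"
    "\<And>x. x \<in> K \<Longrightarrow> inj_on f (U x)"
    using loc by metis
  define W where "W = (B \<times> B) \<inter> (\<lambda>p. (f (fst p), f (snd p))) -` {(a, b) |a b. a \<noteq> b}"
  have "continuous_on (B \<times> B) (\<lambda>p. (f (fst p), f (snd p)))"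
    by (intro continuous_intros continuous_on_compose2[OF \<open>continuous_on B f\<close>]) auto
  moreover have "open {(a :: 'b, b) |a b. a \<noteq> b}"
    by (rule open_diagonal_complement)
  ultimately have "open W"
    unfolding W_def using continuous_open_preimage[OF _ open_Times[OF \<open>open B\<close> \<open>open B\<close>]] by blast
  then have op: "open (W \<union> (\<Union>x\<in>K. U x \<times> U x))"
    using U(1) by (intro open_Un open_UN ballI open_Times) auto
  have sub: "K \<times> K \<subseteq> W \<union> (\<Union>x\<in>K. U x \<times> U x)"
  proof clarify
    fix x y assume xy: "x \<in> K" "y \<in> K" "(x, y) \<notin> (\<Union>x\<in>K. U x \<times> U x)"
    then have "x \<noteq> y" using U(2) by blast
    then have "f x \<noteq> f y" using xy \<open>inj_on f K\<close> by (auto dest: inj_onD)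
    then show "(x, y) \<in> W" using xy \<open>K \<subseteq> B\<close> by (auto simp: W_def)
  qed
  obtain e where e: "e > 0" "(\<Union>p\<in>K \<times> K. ball p e) \<subseteq> W \<union> (\<Union>x\<in>K. U x \<times> U x)"
    by (rule compact_subset_open_imp_ball_epsilon_subset
        [OF compact_Times[OF \<open>compact K\<close> \<open>compact K\<close>] op sub])
  \<comment> \<open>Half of \<open>e\<close> for each coordinate, since the distance of two pairs is
    at most the sum of the coordinate distances.\<close>
  define N where "N = B \<inter> (\<Union>x\<in>K. ball x (e/2))"
  have "inj_on f N"
  proof (rule inj_onI)
    fix x y assume xy: "x \<in> N" "y \<in> N" "f x = f y"
    then obtain a b where ab: "a \<in> K" "b \<in> K" "dist a x < e/2" "dist b y < e/2"
      by (auto simp: N_def)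
    have "dist (a, b) (x, y) \<le> dist a x + dist b y"
      by (simp add: dist_Pair_Pair sqrt_sum_squares_le_sum)
    then have "(x, y) \<in> ball (a, b) e"
      using ab by simp
    then have "(x, y) \<in> W \<union> (\<Union>x\<in>K. U x \<times> U x)"
      using ab by (intro subsetD[OF e(2)] UN_I[of "(a, b)"]) auto
    then show "x = y"
      using xy U(3) by (auto simp: W_def dest: inj_onD)
  qed
  moreover have "K \<subseteq> N" "open N" "N \<subseteq> B"
    using \<open>K \<subseteq> B\<close> \<open>open B\<close> \<open>e > 0\<close> by (auto simp: N_def)
  ultimately show ?thesis by (intro that)
qed

lemma dist_le_dist_image_if_convex_image:
  fixes f :: "'a::euclidean_space \<Rightarrow> 'a"
  assumes "open S" "inj_on f S" "convex (f ` S)"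
    and der: "\<And>x. x \<in> S \<Longrightarrow> (f has_derivative f' x) (at x)"
    and low: "\<And>x v. x \<in> S \<Longrightarrow> norm v \<le> M * norm (f' x v)"
    and "x \<in> S" "y \<in> S"
  shows "dist x y \<le> M * dist (f x) (f y)"
proof -
  let ?g = "inv_into S f"
  \<comment> \<open>The lower bound makes \<open>f' x\<close> injective, hence invertible in finite
    dimension.\<close>
  have "\<exists>g'. linear g' \<and> f' x \<circ> g' = id" if "x \<in> S" for x
  proof -
    have lin: "linear (f' x)" using der[OF that] has_derivative_linear by blast
    have "inj (f' x)"
      unfolding linear_injective_0[OF lin] using low[OF that] by (metis mult_zero_right norm_le_zero_iff norm_zero)
    then show ?thesis
      using linear_injective_isomorphism[OF lin] by (metis comp_apply eq_id_iff ext)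
  qed
  then obtain g' where g': "\<And>x. x \<in> S \<Longrightarrow> linear (g' x)" "\<And>x. x \<in> S \<Longrightarrow> f' x \<circ> g' x = id"
    by metis
  have cont: "continuous_on S f"
    using der has_derivative_continuous_on has_derivative_at_withinI by blast
  have "norm (?g (f x) - ?g (f y)) \<le> M * norm (f x - f y)"
  proof (rule differentiable_bound[OF \<open>convex (f ` S)\<close>])
    fix w assume "w \<in> f ` S"
    then obtain z where z: "z \<in> S" "w = f z" by blast
    show "(?g has_derivative g' (?g w)) (at w within f ` S)"
      using has_derivative_inverse_strong[OF \<open>open S\<close> z(1) cont _ der[OF z(1)] g'(2)[OF z(1)], of ?g]
        \<open>inj_on f S\<close> z by (auto intro: has_derivative_at_withinI)
    show "onorm (g' (?g w)) \<le> M"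
    proof (rule onorm_le)
      fix v
      have "f' z (g' z v) = v" using g'(2)[OF z(1)] by (metis comp_apply id_apply)
      then show "norm (g' (?g w) v) \<le> M * norm v"
        using low[OF z(1), of "g' z v"] z \<open>inj_on f S\<close> by simp
    qed
  qed (use assms in auto)
  then show ?thesis using assms by (simp add: dist_norm)
qed

text \<open>
  Any two open sets around \<open>z0\<close> that \<open>f\<close> maps injectively onto balls around \<open>f z0\<close> are nested,
  so there is a largest one. Were its image smaller than claimed, its closure would be
  a compact subset of \<open>ball z0 \<rho>\<close> on which \<open>f\<close> is still injective, and it could be enlarged.
\<close>

lemma schlicht_ball_if_derivative_bounded_below:
  fixes f :: "'a::euclidean_space \<Rightarrow> 'a"
  assumes "\<rho> > 0" "M > 0"
    and der: "\<And>x. x \<in> ball z0 \<rho> \<Longrightarrow> (f has_derivative f' x) (at x)"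
    and low: "\<And>x v. x \<in> ball z0 \<rho> \<Longrightarrow> norm v \<le> M * norm (f' x v)"
    and loc: "\<And>x. x \<in> ball z0 \<rho> \<Longrightarrow> \<exists>U. open U \<and> x \<in> U \<and> inj_on f U"
  obtains S where "open S" "connected S" "z0 \<in> S" "S \<subseteq> ball z0 \<rho>" "inj_on f S"
    "f ` S = ball (f z0) (\<rho> / M)"
proof -
  define good where "good S r \<longleftrightarrow> open S \<and> z0 \<in> S \<and> S \<subseteq> ball z0 \<rho> \<and> inj_on f S \<and>
    0 < r \<and> r \<le> \<rho> / M \<and> f ` S = ball (f z0) r" for S r
  have cont: "continuous_on (ball z0 \<rho>) f"
    using der has_derivative_continuous_on has_derivative_at_withinI by blast
  have inv: "continuous_on (ball (f z0) r) (inv_into S f)" if "good S r" for S r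
    using that continuous_on_inverse_open[of S f] continuous_on_subset[OF cont, of S]
    by (auto simp: good_def)
  have conn: "connected S" if "good S r" for S r
  proof -
    have "inv_into S f ` ball (f z0) r = S"
      using that by (metis good_def inj_on_imp_bij_betw bij_betw_inv_into bij_betw_imp_surj_on)
    then show ?thesis
      using connected_continuous_image[OF inv[OF that]] by simp
  qed
  \<comment> \<open>\<open>S \<inter> S'\<close> is clopen in the connected set \<open>S\<close> and
    contains \<open>z0\<close>. It is closed because it consists of the points of \<open>S\<close>
    fixed by the continuous map \<open>f\<close> followed by the inverse on
    \<open>S'\<close>.\<close>
  have nested: "S \<subseteq> S'" if S: "good S r" and S': "good S' r'" and "r \<le> r'" for S r S' r'
  proof -
    have "closedin (top_of_set S) (S \<inter> S')"
    proof -
      have eq: "S \<inter> S' = {x \<in> S. inv_into S' f (f x) = x}"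
      proof -
        have "f ` S \<subseteq> f ` S'"
          using S S' \<open>r \<le> r'\<close> by (simp add: good_def subset_ball)
        then have "inv_into S' f (f x) \<in> S'" if "x \<in> S" for x
          using that by (intro inv_into_into) blast
        then show ?thesis using S' by (force simp: good_def)
      qed
      have "continuous_on S (\<lambda>x. inv_into S' f (f x))"
        using S \<open>r \<le> r'\<close> by (intro continuous_on_compose2[OF inv[OF S'], of S f]
            continuous_on_subset[OF cont]) (auto simp: good_def)
      then show ?thesis
        unfolding eq
        using continuous_closedin_preimage_constant[of S "\<lambda>x. inv_into S' f (f x) - x" 0]
        by (simp add: continuous_intros)
    qed
    moreover have "openin (top_of_set S) (S \<inter> S')"
      using S' by (auto simp: good_def intro: openin_open_Int)
    ultimately have "S \<inter> S' = {} \<or> S \<inter> S' = S"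
      using conn[OF S] unfolding connected_clopen by blast
    then show ?thesis using S S' by (auto simp: good_def)
  qed
  \<comment> \<open>Used twice: with \<open>K = {z0}\<close> and \<open>r = 0\<close> it produces a
    first good set, and with the closure of the largest one it yields the contradiction.\<close>
  have extend: "\<exists>S r'. good S r' \<and> (r < \<rho> / M \<longrightarrow> r < r')"
    if "0 \<le> r" "compact K" "z0 \<in> K" "K \<subseteq> ball z0 \<rho>" "inj_on f K" "cball (f z0) r \<subseteq> f ` K" for K r
  proof -
    obtain N where N: "open N" "K \<subseteq> N" "N \<subseteq> ball z0 \<rho>" "inj_on f N"
      using inj_on_open_neighbourhood[OF \<open>compact K\<close> open_ball \<open>K \<subseteq> _\<close> cont \<open>inj_on f K\<close>] loc
        \<open>K \<subseteq> _\<close> by blast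
    have contN: "continuous_on N f" using cont N continuous_on_subset by blast
    have "open (f ` N)" using invariance_of_domain[OF contN] N by blast
    moreover have "cball (f z0) r \<subseteq> f ` N" using that N by blast
    ultimately obtain e where e: "e > 0" "(\<Union>x\<in>cball (f z0) r. ball x e) \<subseteq> f ` N"
      using compact_subset_open_imp_ball_epsilon_subset[OF compact_cball] by metis
    define r' where "r' = min (r + e) (\<rho> / M)"
    have sub: "ball (f z0) r' \<subseteq> f ` N"
    proof -
      have "ball (f z0) (r + e) \<subseteq> (\<Union>x\<in>cball (f z0) r. ball x e)"
      proof
        fix w assume w: "w \<in> ball (f z0) (r + e)"
        show "w \<in> (\<Union>x\<in>cball (f z0) r. ball x e)"
        proof (cases "dist (f z0) w \<le> r")
          case True
          then show ?thesis using e by (auto intro: bexI[of _ w])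
        next
          case False
          define d where "d = dist (f z0) w"
          have d: "d > r" "d > 0" "d < r + e" using False w \<open>0 \<le> r\<close> by (auto simp: d_def)
          \<comment> \<open>The point of the segment from \<open>f z0\<close> to \<open>w\<close>
            that lies on the sphere of radius \<open>r\<close>.\<close>
          define x where "x = f z0 + (r / d) *\<^sub>R (w - f z0)"
          have nd: "norm (w - f z0) = d" by (simp add: d_def dist_norm norm_minus_commute)
          have "dist (f z0) x = r" using d \<open>0 \<le> r\<close> nd by (simp add: x_def dist_norm)
          moreover have "dist x w < e"
          proof -
            have "w - x = (1 - r / d) *\<^sub>R (w - f z0)" by (simp add: x_def algebra_simps)
            then have "norm (w - x) = \<bar>1 - r / d\<bar> * d" by (simp add: nd)
            also have "\<dots> = d - r" using d by (simp add: field_simps abs_if)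
            finally show ?thesis using d by (simp add: dist_norm norm_minus_commute)
          qed
          ultimately show ?thesis by (auto intro: bexI[of _ x])
        qed
      qed
      moreover have "ball (f z0) r' \<subseteq> ball (f z0) (r + e)"
        by (rule subset_ball) (simp add: r'_def)
      ultimately show ?thesis using e(2) by (meson order_trans)
    qed
    have "0 < r'" using e assms(1,2) \<open>0 \<le> r\<close> by (simp add: r'_def)
    then have "good (N \<inter> f -` ball (f z0) r') r'"
      unfolding good_def using sub N that contN
      by (auto simp: r'_def intro: continuous_open_preimage inj_on_subset)
    then show ?thesis using e by (intro exI[of _ "N \<inter> f -` ball (f z0) r'"] exI[of _ r'])
      (auto simp: r'_def)
  qed
  obtain S1 r1 where S1: "good S1 r1"
    using extend[of 0 "{z0}"] assms(1) by auto
  define I where "I = {(S, r). good S r}"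
  define R where "R = (SUP p\<in>I. snd p)"
  define \<Omega> where "\<Omega> = (\<Union>p\<in>I. fst p)"
  have bdd: "bdd_above (snd ` I)"
    by (rule bdd_aboveI[of _ "\<rho> / M"]) (auto simp: I_def good_def)
  have ne: "I \<noteq> {}" using S1 by (auto simp: I_def)
  have le_R: "r \<le> R" if "good S r" for S r
    unfolding R_def using that by (intro cSUP_upper2[OF bdd, of "(S, r)"]) (auto simp: I_def)
  have "R \<le> \<rho> / M"
    unfolding R_def by (rule cSUP_least[OF ne]) (auto simp: I_def good_def)
  \<comment> \<open>By nestedness any two points of the union lie in a common good set, which gives
    injectivity; the images are concentric balls whose radii have supremum \<open>R\<close>.\<close>
  have good\<Omega>: "good \<Omega> R"
  proof -
    have "inj_on f \<Omega>"
    proof (rule inj_onI)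
      fix x y assume xy: "x \<in> \<Omega>" "y \<in> \<Omega>" "f x = f y"
      then obtain S r S' r' where S: "good S r" "x \<in> S" "good S' r'" "y \<in> S'"
        by (auto simp: \<Omega>_def I_def)
      then have "S \<subseteq> S' \<or> S' \<subseteq> S" using nested by (meson linear)
      then show "x = y" using S xy by (auto simp: good_def dest: inj_onD)
    qed
    moreover have "f ` \<Omega> = ball (f z0) R"
    proof -
      have "f ` \<Omega> = (\<Union>p\<in>I. ball (f z0) (snd p))"
        unfolding \<Omega>_def image_UN by (rule SUP_cong) (auto simp: I_def good_def)
      also have "\<dots> = ball (f z0) R"
        by (intro set_eqI) (simp add: R_def less_cSUP_iff[OF ne bdd])
      finally show ?thesis .
    qed
    moreover have "open \<Omega>" "z0 \<in> \<Omega>" "\<Omega> \<subseteq> ball z0 \<rho>"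
      using S1 by (auto simp: \<Omega>_def I_def good_def)
    moreover have "0 < R" using le_R[OF S1] S1 by (simp add: good_def)
    ultimately show ?thesis using \<open>R \<le> \<rho> / M\<close> by (simp add: good_def)
  qed
  have "R = \<rho> / M"
  proof (rule ccontr)
    assume "R \<noteq> \<rho> / M"
    then have less: "R < \<rho> / M" using \<open>R \<le> \<rho> / M\<close> by simp
    \<comment> \<open>The image of \<open>\<Omega>\<close> is a ball, hence convex. The resulting
      estimate confines \<open>\<Omega>\<close> to \<open>cball z0 (M * R)\<close>, strictly inside
      \<open>ball z0 \<rho>\<close>; passed to limits, it also makes \<open>f\<close> injective on
      the closure.\<close>
    have dist_le: "dist x y \<le> M * dist (f x) (f y)" if "x \<in> \<Omega>" "y \<in> \<Omega>" for x y
      by (rule dist_le_dist_image_if_convex_image[of \<Omega> f f'])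
        (use good\<Omega> that der low in \<open>auto simp: good_def\<close>)
    have cl: "closure \<Omega> \<subseteq> cball z0 (M * R)"
    proof (rule closure_minimal)
      show "\<Omega> \<subseteq> cball z0 (M * R)"
      proof
        fix x assume "x \<in> \<Omega>"
        then have "dist z0 x \<le> M * dist (f z0) (f x)" "f x \<in> ball (f z0) R"
          using dist_le good\<Omega> by (auto simp: good_def)
        then show "x \<in> cball z0 (M * R)"
          using \<open>M > 0\<close> by (smt (verit, best) mem_ball mem_cball mult_le_cancel_left_pos)
      qed
    qed simp
    have "M * R < \<rho>" using less \<open>M > 0\<close> by (simp add: field_simps)
    then have clB: "closure \<Omega> \<subseteq> ball z0 \<rho>" using cl by force
    have contcl: "continuous_on (closure \<Omega>) f" using continuous_on_subset[OF cont clB] .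
    have comp: "compact (closure \<Omega>)"
      using cl bounded_subset[OF bounded_cball] by (simp add: compact_eq_bounded_closed)
    have "inj_on f (closure \<Omega>)"
    proof (rule inj_onI)
      fix x y assume xy: "x \<in> closure \<Omega>" "y \<in> closure \<Omega>" "f x = f y"
      obtain u v where u: "\<And>n::nat. u n \<in> \<Omega>" "u \<longlonglongrightarrow> x" and v: "\<And>n::nat. v n \<in> \<Omega>" "v \<longlonglongrightarrow> y"
        using xy(1,2) unfolding closure_sequential by blast
      have "(\<lambda>n. f (u n)) \<longlonglongrightarrow> f x"
        by (rule continuous_on_tendsto_compose[OF contcl u(2) xy(1)])
          (use u(1) closure_subset in \<open>auto intro!: always_eventually\<close>)
      moreover have "(\<lambda>n. f (v n)) \<longlonglongrightarrow> f y"
        by (rule continuous_on_tendsto_compose[OF contcl v(2) xy(2)])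
          (use v(1) closure_subset in \<open>auto intro!: always_eventually\<close>)
      ultimately have "(\<lambda>n. M * dist (f (u n)) (f (v n))) \<longlonglongrightarrow> M * dist (f x) (f y)"
        by (intro tendsto_intros)
      moreover have "(\<lambda>n. dist (u n) (v n)) \<longlonglongrightarrow> dist x y"
        by (intro tendsto_intros u v)
      ultimately have "dist x y \<le> M * dist (f x) (f y)"
        using LIMSEQ_le dist_le u(1) v(1) by blast
      then show "x = y" using xy by simp
    qed
    moreover have "cball (f z0) R \<subseteq> f ` closure \<Omega>"
    proof -
      have "closure (f ` \<Omega>) \<subseteq> f ` closure \<Omega>"
        using compact_imp_closed[OF compact_continuous_image[OF contcl comp]]
        by (intro closure_minimal image_mono closure_subset)
      then show ?thesis using good\<Omega> by (simp add: good_def)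
    qed
    moreover have "z0 \<in> closure \<Omega>" "0 \<le> R"
      using good\<Omega> closure_subset[of \<Omega>] by (auto simp: good_def)
    ultimately obtain S r where "good S r" "R < r"
      using extend[OF _ comp _ clB] less by blast
    then show False using le_R by fastforce
  qed
  then show ?thesis
    using that[of \<Omega>] good\<Omega> conn[OF good\<Omega>] by (simp add: good_def)
qed

section \<open>Matrix norms and determinants\<close>

lemma norm_matrix_component_le_onorm:
  fixes A :: "complex ^ 'n ^ 'm"
  shows "norm (A $ i $ j) \<le> onorm ((*v) A)"
proof -
  have "A $ i $ j = (A *v axis j 1) $ i"
    by (simp add: matrix_vector_mult_def axis_def if_distrib cong: if_cong)
  also have "norm \<dots> \<le> norm (A *v axis j 1)" by (rule Finite_Cartesian_Product.norm_nth_le)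
  also have "\<dots> \<le> onorm ((*v) A) * norm (axis j (1::complex))"
    by (rule onorm) simp
  also have "norm (axis j (1::complex)) = 1"
    by (rule norm_Basis) (simp add: axis_in_Basis_iff Basis_complex_def)
  finally show ?thesis by simp
qed

lemma onorm_matrix_le_sum_norm_components:
  fixes A :: "complex ^ 'n ^ 'm"
  shows "onorm ((*v) A) \<le> (\<Sum>i\<in>UNIV. \<Sum>j\<in>UNIV. norm (A $ i $ j))"
proof (rule onorm_le)
  fix x :: "complex ^ 'n"
  have "norm (A *v x) \<le> (\<Sum>i\<in>UNIV. norm ((A *v x) $ i))"
    unfolding norm_vec_def by (rule L2_set_le_sum) simp
  also have "\<dots> \<le> (\<Sum>i\<in>UNIV. \<Sum>j\<in>UNIV. norm (A $ i $ j) * norm x)"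
    unfolding matrix_vector_mult_def vec_lambda_beta
    by (intro sum_mono sum_norm_le)
      (simp add: norm_mult mult_left_mono Finite_Cartesian_Product.norm_nth_le)
  finally show "norm (A *v x) \<le> (\<Sum>i\<in>UNIV. \<Sum>j\<in>UNIV. norm (A $ i $ j)) * norm x"
    by (simp add: sum_distrib_right)
qed

text \<open>Each of the \<open>n!\<close> Leibniz terms takes exactly one entry from every
  column.\<close>

lemma norm_det_le_prod_column_bounds:
  fixes A :: "'a::real_normed_field ^ 'n ^ 'n"
  assumes "\<And>i j. norm (A $ i $ j) \<le> c j"
  shows "norm (det A) \<le> fact CARD('n) * (\<Prod>j\<in>UNIV. c j)"
proof -
  have "norm (of_int (sign p) * (\<Prod>i\<in>UNIV. A $ i $ p i)) \<le> (\<Prod>j\<in>UNIV. c j)"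
    if "p permutes (UNIV :: 'n set)" for p
  proof -
    have "norm (of_int (sign p) * (\<Prod>i\<in>UNIV. A $ i $ p i)) = (\<Prod>i\<in>UNIV. norm (A $ i $ p i))"
      by (simp add: sign_def norm_mult prod_norm)
    also have "\<dots> \<le> (\<Prod>i\<in>UNIV. c (p i))"
      by (intro prod_mono) (auto simp: assms)
    also have "\<dots> = (\<Prod>j\<in>UNIV. c j)"
      using prod.permute[OF that, of c] by (simp add: o_def)
    finally show ?thesis .
  qed
  then have "norm (det A) \<le> real (card {p. p permutes (UNIV :: 'n set)}) * (\<Prod>j\<in>UNIV. c j)"
    unfolding det_def by (intro sum_norm_bound) auto
  then show ?thesis by (simp add: card_permutations[OF refl])
qed

text \<open>By Cramer's rule each component of \<open>v\<close>, multiplied by the determinant, is a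
  determinant with one column replaced by \<open>A *v v\<close>. The other \<open>n - 1\<close>
  columns contribute the power of \<open>b\<close>, and summing over the components gives the factor
  \<open>n\<close>.\<close>

lemma norm_det_mult_norm_le:
  fixes A :: "complex ^ 'n ^ 'n" and b :: real
  assumes "\<And>i j. norm (A $ i $ j) \<le> b"
  shows "norm (det A) * norm v \<le> real CARD('n) * fact CARD('n) * b ^ (CARD('n) - 1) * norm (A *v v)"
proof (cases "det A = 0")
  case True
  have "0 \<le> b" using assms norm_ge_zero order_trans by blast
  then show ?thesis using True by simp
next
  case False
  define w where "w = A *v v"
  have v: "v = (\<chi> k. det (\<chi> i j. if j = k then w $ i else A $ i $ j) / det A)"
    using cramer[OF False, of v w] w_def by simp
  have "norm (det A) * norm (v $ k) \<le> fact CARD('n) * b ^ (CARD('n) - 1) * norm w" for k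
  proof -
    have "norm (det A) * norm (v $ k) = norm (det (\<chi> i j. if j = k then w $ i else A $ i $ j))"
      using False by (subst v) (simp add: norm_divide)
    also have "\<dots> \<le> fact CARD('n) * (\<Prod>j\<in>UNIV. if j = k then norm w else b)"
      by (rule norm_det_le_prod_column_bounds) (simp add: assms Finite_Cartesian_Product.norm_nth_le)
    also have "(\<Prod>j\<in>UNIV. if j = k then norm w else b) = norm w * b ^ (CARD('n) - 1)"
      by (simp add: prod.remove[of UNIV k] card_Diff_singleton)
    finally show ?thesis by (simp add: mult_ac)
  qed
  then have "(\<Sum>k\<in>UNIV. norm (det A) * norm (v $ k))
      \<le> of_nat CARD('n) * (fact CARD('n) * b ^ (CARD('n) - 1) * norm w)"
    by (intro sum_bounded_above) auto
  moreover have "norm v \<le> (\<Sum>k\<in>UNIV. norm (v $ k))"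
    unfolding norm_vec_def by (rule L2_set_le_sum) simp
  then have "norm (det A) * norm v \<le> (\<Sum>k\<in>UNIV. norm (det A) * norm (v $ k))"
    by (simp add: mult_left_mono flip: sum_distrib_left)
  ultimately show ?thesis by (simp add: w_def mult_ac)
qed

section \<open>Regularity of the complex Jacobian\<close>

lemma bounded_linear_scalar_mult_vec: "bounded_linear (\<lambda>t::complex. t *s (v :: complex ^ 'n))"
  by (intro linear_conv_bounded_linear[THEN iffD1] linearI) (auto simp: vec_eq_iff algebra_simps)

lemma norm_scalar_mult_vec: "norm (t *s v) = norm t * norm (v :: complex ^ 'n)"
  by (simp add: norm_vec_def norm_mult L2_set_right_distrib)

lemma norm_scalar_mult_axis: "norm (t *s axis j 1 :: complex ^ 'n) = norm t"
proof -
  have "norm (axis j 1 :: complex ^ 'n) = 1"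
    by (rule norm_Basis) (simp add: axis_in_Basis_iff Basis_complex_def)
  then show ?thesis by (simp add: norm_scalar_mult_vec)
qed

lemma add_mem_cball:
  fixes a :: "'a::real_normed_vector"
  assumes "z \<in> cball a r" "norm w \<le> s"
  shows "z + w \<in> cball a (r + s)"
  using assms norm_triangle_ineq4[of "a - z" w] by (simp add: dist_norm diff_diff_eq)

lemma has_derivative_complex_jacobian:
  assumes "holomorphic_map_on F S" "z \<in> S"
  shows "(F has_derivative ((*v) (complex_jacobian F z))) (at z)"
  using assms complex_jacobian_eq unfolding holomorphic_map_on_def by metis

text \<open>Restriction to complex lines makes one-variable function theory applicable.\<close>

lemma has_field_derivative_along_line:
  fixes F :: "complex ^ 'n \<Rightarrow> complex ^ 'm"
  assumes F: "holomorphic_map_on F S" and "a + t *s v \<in> S"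
  shows "((\<lambda>t. F (a + t *s v) $ i) has_field_derivative
    (complex_jacobian F (a + t *s v) *v v) $ i) (at t)"
proof -
  let ?J = "complex_jacobian F (a + t *s v)"
  have "((\<lambda>t. a + t *s v) has_derivative (\<lambda>h. h *s v)) (at t)"
    by (auto intro!: derivative_eq_intros
        bounded_linear_imp_has_derivative[OF bounded_linear_scalar_mult_vec])
  from diff_chain_at[OF this has_derivative_complex_jacobian[OF assms]]
  have "((\<lambda>t. F (a + t *s v) $ i) has_derivative (\<lambda>h. (?J *v (h *s v)) $ i)) (at t)"
    unfolding o_def by (rule bounded_linear.has_derivative[OF bounded_linear_vec_nth])
  moreover have "(?J *v (h *s v)) $ i = (?J *v v) $ i * h" for h
    by (simp add: matrix_vector_mult_def sum_distrib_left mult_ac)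
  ultimately show ?thesis by (simp add: has_field_derivative_def)
qed

text \<open>First-order Taylor expansion, with the second derivative on the half disk bounded by
  Cauchy's estimate. The constant depends on \<open>g\<close> only through \<open>B\<close>, which
  is what makes the convergence of difference quotients uniform.\<close>

lemma norm_difference_quotient_minus_deriv_le:
  assumes hol: "g holomorphic_on ball 0 r" and bd: "\<And>z. z \<in> ball 0 r \<Longrightarrow> norm (g z) \<le> B"
    and t: "t \<noteq> 0" "norm t < r / 2"
  shows "norm ((g t - g 0) / t - deriv g 0) \<le> 32 * (B + 1) / r\<^sup>2 * norm t"
proof -
  have r: "r > 0" using t norm_ge_zero[of t] by linarith
  have sub: "cball x (r/4) \<subseteq> ball 0 r" if "x \<in> ball 0 (r/2)" for x :: complex
    using that r by (simp add: cball_subset_ball_iff dist_commute)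
  have "norm ((deriv ^^ 0) g t - (\<Sum>i\<le>1. (deriv ^^ i) g 0 * (t - 0) ^ i / fact i))
    \<le> 32 * (B + 1) / r\<^sup>2 * norm (t - 0) ^ Suc 1 / fact 1"
  proof (rule complex_Taylor[of "ball 0 (r/2)"])
    fix i and x :: complex assume x: "x \<in> ball 0 (r/2)"
    then have "x \<in> ball 0 r" using r by auto
    then have "(deriv ^^ i) g field_differentiable at x"
      using holomorphic_higher_deriv[OF hol] holomorphic_on_imp_differentiable_at by blast
    then show "((deriv ^^ i) g has_field_derivative (deriv ^^ Suc i) g x) (at x within ball 0 (r/2))"
      by (simp add: field_differentiable_derivI has_field_derivative_at_within)
  next
    fix x :: complex assume x: "x \<in> ball 0 (r/2)"
    \<comment> \<open>Cauchy's estimate on a disk of radius \<open>r/4\<close> gives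
      \<open>2 * 16 = 32\<close>. It takes values in an open ball, hence \<open>B + 1\<close> in
      place of \<open>B\<close>.\<close>
    have "norm ((deriv ^^ 2) g x) \<le> fact 2 * (B + 1) / (r/4) ^ 2"
    proof (rule Cauchy_higher_deriv_bound)
      show "g holomorphic_on ball x (r/4)" "continuous_on (cball x (r/4)) g"
        using hol sub[OF x] ball_subset_cball
        by (meson holomorphic_on_subset holomorphic_on_imp_continuous_on order_trans)+
      show "g w \<in> ball 0 (B + 1)" if "w \<in> ball x (r/4)" for w
        using bd[of w] sub[OF x] ball_subset_cball that by fastforce
    qed (use r in auto)
    then show "norm ((deriv ^^ Suc 1) g x) \<le> 32 * (B + 1) / r\<^sup>2"
      by (simp add: numeral_2_eq_2 power2_eq_square)
  qed (use r t in auto)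
  then have "norm (g t - g 0 - deriv g 0 * t) \<le> 32 * (B + 1) / r\<^sup>2 * norm t * norm t"
    by (simp add: power2_eq_square algebra_simps)
  moreover have "g t - g 0 - deriv g 0 * t = ((g t - g 0) / t - deriv g 0) * t"
    using t by (simp add: field_simps)
  ultimately have "norm ((g t - g 0) / t - deriv g 0) * norm t
      \<le> 32 * (B + 1) / r\<^sup>2 * norm t * norm t"
    by (simp only: norm_mult)
  then show ?thesis
    by (rule mult_right_le_imp_le) (use t in auto)
qed

text \<open>Differentiability is only assumed pointwise. Writing the partial derivatives as locally
  uniform limits of difference quotients lets them inherit continuity, and holomorphy along lines,
  from \<open>F\<close>. The larger ball of radius \<open>2 * \<delta>\<close> supplies a common
  bound for \<open>F\<close> on all the shifted points.\<close>

lemma uniform_limit_difference_quotient: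
  fixes F :: "complex ^ 'n \<Rightarrow> complex ^ 'm"
  assumes F: "holomorphic_map_on F S" and "\<delta> > 0" and sub: "cball a (2 * \<delta>) \<subseteq> S"
  defines "t \<equiv> \<lambda>n. complex_of_real (\<delta> / (real n + 3))"
  shows "uniform_limit (cball a \<delta>)
    (\<lambda>n z. (F (z + t n *s axis j 1) $ i - F z $ i) / t n)
    (\<lambda>z. complex_jacobian F z $ i $ j) sequentially"
proof -
  have "continuous_on (cball a (2 * \<delta>)) F"
    using has_derivative_complex_jacobian[OF F] sub has_derivative_continuous
    by (meson continuous_at_imp_continuous_on subsetD)
  then have "bounded (F ` cball a (2 * \<delta>))"
    by (intro compact_imp_bounded compact_continuous_image) auto
  then obtain B where B: "\<And>z. z \<in> cball a (2 * \<delta>) \<Longrightarrow> norm (F z) \<le> B"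
    unfolding bounded_iff by blast
  define L where "L = 32 * (B + 1) / \<delta>\<^sup>2"
  have bound: "norm ((F (z + t n *s axis j 1) $ i - F z $ i) / t n - complex_jacobian F z $ i $ j)
      \<le> L * norm (t n)" if z: "z \<in> cball a \<delta>" for z n
  proof -
    define g where "g s = F (z + s *s axis j 1) $ i" for s
    have mem: "z + s *s axis j 1 \<in> cball a (2 * \<delta>)" if "s \<in> ball 0 \<delta>" for s
      using add_mem_cball[OF z, of "s *s axis j 1" \<delta>] that by (simp add: norm_scalar_mult_axis)
    have der: "(g has_field_derivative (complex_jacobian F (z + s *s axis j 1) *v axis j 1) $ i) (at s)"
      if "s \<in> ball 0 \<delta>" for s
      unfolding g_def using mem[OF that] sub by (intro has_field_derivative_along_line[OF F]) auto
    have "g holomorphic_on ball 0 \<delta>"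
      using der by (meson holomorphic_onI field_differentiable_def field_differentiable_at_within)
    moreover have "norm (g s) \<le> B" if "s \<in> ball 0 \<delta>" for s
      unfolding g_def using B[OF mem[OF that]] Finite_Cartesian_Product.norm_nth_le order_trans by blast
    \<comment> \<open>The summand 3 keeps every increment, including that for \<open>n = 0\<close>,
      strictly below \<open>\<delta> / 2\<close>.\<close>
    moreover have "\<delta> / (real n + 3) < \<delta> / 2"
      by (rule divide_strict_left_mono) (use \<open>\<delta> > 0\<close> in auto)
    then have "t n \<noteq> 0" "norm (t n) < \<delta> / 2"
      using \<open>\<delta> > 0\<close> unfolding t_def norm_of_real by (simp_all flip: of_real_add)
    ultimately have "norm ((g (t n) - g 0) / t n - deriv g 0) \<le> L * norm (t n)"
      unfolding L_def by (rule norm_difference_quotient_minus_deriv_le)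
    moreover have "deriv g 0 = complex_jacobian F z $ i $ j"
      using DERIV_imp_deriv[OF der[of 0]] \<open>\<delta> > 0\<close>
      by (simp add: matrix_vector_mult_def axis_def if_distrib cong: if_cong)
    ultimately show ?thesis by (simp add: g_def)
  qed
  have "filterlim (\<lambda>n. 3 + real n) at_top sequentially"
    by (rule filterlim_tendsto_add_at_top[OF tendsto_const filterlim_real_sequentially])
  then have "(\<lambda>n. \<delta> / (3 + real n)) \<longlonglongrightarrow> 0"
    by (rule real_tendsto_divide_at_top[OF tendsto_const])
  then have "(\<lambda>n. L * norm (t n)) \<longlonglongrightarrow> 0"
    unfolding t_def norm_of_real
    by (intro tendsto_mult_right_zero tendsto_rabs_zero) (simp add: add.commute)
  then have ev: "\<forall>\<^sub>F n in sequentially. L * norm (t n) < e" if "e > 0" for e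
    using that order_tendstoD(2) by blast
  show ?thesis
  proof (rule uniform_limitI)
    fix e :: real assume "e > 0"
    from ev[OF this] show "\<forall>\<^sub>F n in sequentially. \<forall>z\<in>cball a \<delta>.
      dist ((F (z + t n *s axis j 1) $ i - F z $ i) / t n) (complex_jacobian F z $ i $ j) < e"
      by eventually_elim (intro ballI, unfold dist_norm, rule le_less_trans[OF bound])
  qed
qed

lemma continuous_on_complex_jacobian:
  fixes F :: "complex ^ 'n \<Rightarrow> complex ^ 'm"
  assumes F: "holomorphic_map_on F S" and "open S"
  shows "continuous_on S (\<lambda>z. complex_jacobian F z $ i $ j)"
proof (rule continuous_at_imp_continuous_on, rule ballI)
  fix a assume "a \<in> S"
  then obtain \<epsilon> where \<epsilon>: "\<epsilon> > 0" "cball a \<epsilon> \<subseteq> S"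
    using \<open>open S\<close> open_contains_cball by blast
  define \<delta> where "\<delta> = \<epsilon> / 2"
  have \<delta>: "\<delta> > 0" "cball a (2 * \<delta>) \<subseteq> S" using \<epsilon> by (auto simp: \<delta>_def)
  define t where "t n = complex_of_real (\<delta> / (real n + 3))" for n
  have contF: "continuous_on S F"
    using has_derivative_complex_jacobian[OF F] has_derivative_continuous
    by (meson continuous_at_imp_continuous_on)
  have nt: "norm (t n) \<le> \<delta>" for n
    using \<open>\<delta> > 0\<close> unfolding t_def norm_of_real by (simp add: field_simps)
  have shift: "z + t n *s axis j 1 \<in> S" if "z \<in> cball a \<delta>" for z n
    using add_mem_cball[OF that, of "t n *s axis j 1" \<delta>] nt[of n] \<delta>(2)
    by (auto simp: norm_scalar_mult_axis)
  have "continuous_on (cball a \<delta>) (\<lambda>z. complex_jacobian F z $ i $ j)"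
  proof (rule uniform_limit_theorem)
    show "uniform_limit (cball a \<delta>) (\<lambda>n z. (F (z + t n *s axis j 1) $ i - F z $ i) / t n)
      (\<lambda>z. complex_jacobian F z $ i $ j) sequentially"
      unfolding t_def by (rule uniform_limit_difference_quotient[OF F \<delta>])
    have "cball a \<delta> \<subseteq> S" using \<delta> by (auto simp: subset_iff)
    moreover have "t n \<noteq> 0" for n using \<open>\<delta> > 0\<close> by (simp add: t_def flip: of_real_add)
    ultimately show "\<forall>\<^sub>F n in sequentially. continuous_on (cball a \<delta>)
      (\<lambda>z. (F (z + t n *s axis j 1) $ i - F z $ i) / t n)"
      using shift by (intro always_eventually allI continuous_intros
          continuous_on_compose2[OF contF] continuous_on_subset[OF contF]) auto
  qed auto
  then show "isCont (\<lambda>z. complex_jacobian F z $ i $ j) a"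
    using \<open>\<delta> > 0\<close> by (intro continuous_on_interior[of "cball a \<delta>"]) auto
qed

text \<open>Along a line the difference quotients of \<open>F\<close> are holomorphic in
  \<open>s\<close>, and locally uniform limits of holomorphic functions are holomorphic.\<close>

lemma holomorphic_on_complex_jacobian_along_line:
  fixes F :: "complex ^ 'n \<Rightarrow> complex ^ 'm"
  assumes F: "holomorphic_map_on F S" and "open S"
  shows "(\<lambda>s. complex_jacobian F (a + s *s v) $ i $ j) holomorphic_on {s. a + s *s v \<in> S}"
proof (rule holomorphic_onI)
  fix s0 assume "s0 \<in> {s. a + s *s v \<in> S}"
  then obtain \<epsilon> where \<epsilon>: "\<epsilon> > 0" "cball (a + s0 *s v) \<epsilon> \<subseteq> S"
    using \<open>open S\<close> open_contains_cball by blast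
  define \<delta> where "\<delta> = \<epsilon> / 2"
  have \<delta>: "\<delta> > 0" "cball (a + s0 *s v) (2 * \<delta>) \<subseteq> S" using \<epsilon> by (auto simp: \<delta>_def)
  define t where "t n = complex_of_real (\<delta> / (real n + 3))" for n
  \<comment> \<open>Chosen so that the line stays within \<open>\<delta>\<close> of its point at
    \<open>s0\<close>; the added 1 covers \<open>v = 0\<close>.\<close>
  define e where "e = \<delta> / (norm v + 1)"
  have "e > 0" using \<open>\<delta> > 0\<close> by (simp add: e_def add_nonneg_pos)
  have "norm v + 1 > 0" by (simp add: add_nonneg_pos)
  then have "e * norm v \<le> \<delta>" using \<open>\<delta> > 0\<close> by (simp add: e_def divide_le_eq)
  have line: "a + s *s v \<in> cball (a + s0 *s v) \<delta>" if "s \<in> cball s0 e" for s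
  proof -
    have "dist (a + s0 *s v) (a + s *s v) = norm ((s0 - s) *s v)"
      by (simp add: dist_norm vector_sub_rdistrib)
    also have "\<dots> \<le> e * norm v"
      unfolding norm_scalar_mult_vec using that by (intro mult_right_mono) (auto simp: dist_norm)
    finally show ?thesis using \<open>e * norm v \<le> \<delta>\<close> by simp
  qed
  have nt: "norm (t n) \<le> \<delta>" for n
    using \<open>\<delta> > 0\<close> unfolding t_def norm_of_real by (simp add: field_simps)
  have shift: "z + t n *s axis j 1 \<in> S" if "z \<in> cball (a + s0 *s v) \<delta>" for z n
    using add_mem_cball[OF that, of "t n *s axis j 1" \<delta>] nt[of n] \<delta>(2)
    by (auto simp: norm_scalar_mult_axis)
  have hol: "(\<lambda>s. (F (a + s *s v + t n *s axis j 1) $ i - F (a + s *s v) $ i) / t n)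
    holomorphic_on cball s0 e" for n
  proof -
    have "(\<lambda>s. F (b + s *s v) $ i) holomorphic_on cball s0 e"
      if "\<And>s. s \<in> cball s0 e \<Longrightarrow> b + s *s v \<in> S" for b
      using has_field_derivative_along_line[OF F that]
      by (intro holomorphic_onI) (meson field_differentiable_at_within field_differentiable_def)
    note this[of a] this[of "a + t n *s axis j 1"]
    moreover have "a + s *s v \<in> S" if "s \<in> cball s0 e" for s
      using line[OF that] \<delta> by auto
    moreover have "a + t n *s axis j 1 + s *s v \<in> S" if "s \<in> cball s0 e" for s
      using shift[OF line[OF that], of n] by (simp add: add_ac)
    ultimately have "(\<lambda>s. F (a + s *s v) $ i) holomorphic_on cball s0 e"
      "(\<lambda>s. F (a + t n *s axis j 1 + s *s v) $ i) holomorphic_on cball s0 e"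
      by blast+
    moreover have "t n \<noteq> 0" using \<open>\<delta> > 0\<close> by (simp add: t_def flip: of_real_add)
    ultimately show ?thesis by (auto intro!: holomorphic_intros simp: add_ac)
  qed
  have "uniform_limit (cball s0 e)
      (\<lambda>n s. (F (a + s *s v + t n *s axis j 1) $ i - F (a + s *s v) $ i) / t n)
      (\<lambda>s. complex_jacobian F (a + s *s v) $ i $ j) sequentially"
    using line unfolding t_def
    by (intro uniform_limit_compose'[OF uniform_limit_difference_quotient[OF F \<delta>]]) auto
  then have "(\<lambda>s. complex_jacobian F (a + s *s v) $ i $ j) holomorphic_on ball s0 e"
    by (rule holomorphic_uniform_limit[rotated])
      (use holomorphic_on_imp_continuous_on[OF hol] holomorphic_on_subset[OF hol ball_subset_cball]
        in \<open>auto intro!: always_eventually\<close>)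
  then show "(\<lambda>s. complex_jacobian F (a + s *s v) $ i $ j) field_differentiable
      at s0 within {s. a + s *s v \<in> S}"
    using \<open>e > 0\<close> holomorphic_on_imp_differentiable_at field_differentiable_at_within
    by (metis centre_in_ball open_ball)
qed

text \<open>The entries of the Jacobian are continuous, so the derivative is continuous in operator
  norm at \<open>a\<close>; invertibility there gives local injectivity as in the inverse function
  theorem.\<close>

lemma locally_injective_if_det_complex_jacobian_nonzero:
  fixes F :: "complex ^ 'm \<Rightarrow> complex ^ 'm"
  assumes F: "holomorphic_map_on F S" and "open S" "a \<in> S" and "det (complex_jacobian F a) \<noteq> 0"
  shows "\<exists>U. open U \<and> a \<in> U \<and> inj_on F U"
proof -
  let ?J = "complex_jacobian F"
  obtain B where B: "B ** ?J a = mat 1"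
    using assms(4) unfolding invertible_det_nz[symmetric] invertible_def by blast
  \<comment> \<open>The sum of the entry differences dominates the operator norm of the
    difference.\<close>
  define \<phi> where "\<phi> z = (\<Sum>i\<in>UNIV. \<Sum>j\<in>UNIV. norm (?J z $ i $ j - ?J a $ i $ j))" for z
  have "isCont (\<lambda>z. ?J z $ i $ j) a" for i j
    using continuous_on_complex_jacobian[OF F \<open>open S\<close>] \<open>open S\<close> \<open>a \<in> S\<close>
      continuous_on_eq_continuous_at by blast
  then have "isCont \<phi> a"
    unfolding \<phi>_def
    by (intro continuous_sum continuous_norm continuous_diff continuous_const)
  then have lim: "(\<phi> \<longlongrightarrow> 0) (at a)"
    by (simp add: isCont_def \<phi>_def)
  have small: "\<exists>d>0. \<forall>x. dist a x < d \<longrightarrow> onorm (\<lambda>v. ?J x *v v - ?J a *v v) < e"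
    if "e > 0" for e
  proof -
    obtain d where d: "d > 0" "\<And>x. x \<noteq> a \<Longrightarrow> dist x a < d \<Longrightarrow> \<bar>\<phi> x\<bar> < e"
      using LIM_D[OF lim \<open>e > 0\<close>] by (auto simp: dist_norm)
    have "onorm (\<lambda>v. ?J x *v v - ?J a *v v) < e" if "dist a x < d" for x
    proof -
      have "(\<lambda>v. ?J x *v v - ?J a *v v) = (*v) (?J x - ?J a)"
        by (rule ext) (simp add: matrix_vector_mult_diff_rdistrib)
      then have "onorm (\<lambda>v. ?J x *v v - ?J a *v v) = onorm ((*v) (?J x - ?J a))"
        by simp
      also have "\<dots> \<le> \<phi> x"
        using onorm_matrix_le_sum_norm_components[of "?J x - ?J a"] by (simp add: \<phi>_def)
      also have "\<phi> x < e"
        using d(2)[of x] that \<open>e > 0\<close> by (cases "x = a") (auto simp: dist_commute \<phi>_def)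
      finally show ?thesis .
    qed
    then show ?thesis using d(1) by blast
  qed
  have inv: "(*v) B \<circ> (*v) (?J a) = id"
    by (simp add: fun_eq_iff matrix_vector_mul_assoc B)
  show ?thesis
    by (rule has_derivative_locally_injective[OF \<open>a \<in> S\<close> \<open>open S\<close> _ inv _ small])
      (use has_derivative_complex_jacobian[OF F] in \<open>auto intro: centre_in_ball[THEN iffD2]\<close>)
qed

section \<open>The Jacobian determinant along lines and a Schwarz estimate\<close>

lemma continuous_on_det_complex_jacobian:
  fixes F :: "complex ^ 'm \<Rightarrow> complex ^ 'm"
  assumes "holomorphic_map_on F S" "open S"
  shows "continuous_on S (\<lambda>z. det (complex_jacobian F z))"
  unfolding det_def by (intro continuous_intros continuous_on_complex_jacobian[OF assms])

lemma holomorphic_on_det_complex_jacobian_along_line: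
  fixes F :: "complex ^ 'm \<Rightarrow> complex ^ 'm"
  assumes "holomorphic_map_on F S" "open S"
  shows "(\<lambda>s. det (complex_jacobian F (a + s *s v))) holomorphic_on {s. a + s *s v \<in> S}"
  unfolding det_def
  by (intro holomorphic_intros holomorphic_on_complex_jacobian_along_line[OF assms])

text \<open>The Schwarz lemma for \<open>h\<close>, rescaled to the unit disk, shifted to vanish at
  0 and divided by \<open>4 * B\<close>. The difference is at most \<open>2 * B\<close>, so the
  larger divisor gives values strictly inside the unit disk.\<close>

lemma norm_diff_le_of_bounded_holomorphic:
  assumes hol: "h holomorphic_on ball 0 r" and bd: "\<And>z. z \<in> ball 0 r \<Longrightarrow> norm (h z) \<le> B"
    and "B > 0" "z \<in> ball 0 r"
  shows "norm (h z - h 0) \<le> 4 * B * norm z / r"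
proof -
  have r: "r > 0" using \<open>z \<in> ball 0 r\<close> norm_ge_zero[of z] by (simp del: norm_ge_zero)
  define f where "f w = (h (of_real r * w) - h 0) / of_real (4 * B)" for w
  have scale: "of_real r * w \<in> ball 0 r" if "norm w < 1" for w :: complex
    using r that by (simp add: norm_mult)
  have "(h \<circ> (\<lambda>w. of_real r * w)) holomorphic_on ball 0 1"
    by (rule holomorphic_on_compose_gen[OF _ hol]) (use scale in \<open>auto intro!: holomorphic_intros\<close>)
  then have "f holomorphic_on ball 0 1"
    using \<open>B > 0\<close> unfolding f_def o_def by (intro holomorphic_intros) auto
  moreover have "f 0 = 0" by (simp add: f_def)
  moreover have "norm (f w) < 1" if "norm w < 1" for w
  proof -
    have "norm (h (of_real r * w) - h 0) \<le> norm (h (of_real r * w)) + norm (h 0)"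
      by (rule norm_triangle_ineq4)
    also have "\<dots> < 4 * B"
      using bd[OF scale[OF that]] bd[of 0] r \<open>B > 0\<close> by simp
    finally show ?thesis using \<open>B > 0\<close> by (simp add: f_def norm_divide)
  qed
  moreover have "norm (z / of_real r) < 1"
    using r \<open>z \<in> ball 0 r\<close> by (simp add: norm_divide)
  ultimately have "norm (f (z / of_real r)) \<le> norm (z / of_real r)"
    by (rule Schwarz_Lemma(1))
  then show ?thesis
    using r \<open>B > 0\<close> by (simp add: f_def norm_divide field_simps)
qed

section \<open>Wu mappings\<close>

lemma open_unit_polydisk: "open (unit_polydisk :: (complex ^ 'm) set)"
proof -
  have "open (\<Inter>j\<in>UNIV. {z :: complex ^ 'm. norm (z $ j) < 1})"
    by (intro open_INT ballI open_Collect_less continuous_intros) auto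
  moreover have "(\<Inter>j\<in>UNIV. {z :: complex ^ 'm. norm (z $ j) < 1}) = unit_polydisk"
    by (auto simp: unit_polydisk_def)
  ultimately show ?thesis by simp
qed

lemma ball_subset_unit_polydisk: "ball 0 1 \<subseteq> (unit_polydisk :: (complex ^ 'm) set)"
  unfolding unit_polydisk_def using Finite_Cartesian_Product.norm_nth_le le_less_trans by fastforce

lemma Wu_mapping_norm_component_le:
  fixes F :: "complex ^ 'm \<Rightarrow> complex ^ 'm"
  assumes "Wu_mapping K F" "z \<in> unit_polydisk"
  shows "norm (complex_jacobian F z $ i $ j)
    \<le> K * norm (det (complex_jacobian F z)) powr (1 / real CARD('m))"
  using assms norm_matrix_component_le_onorm[of "complex_jacobian F z"]
  unfolding Wu_mapping_def by (meson order_trans)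

text \<open>The Wu condition bounds the entries by \<open>K * x\<close> with \<open>x ^ m\<close>
  the modulus of the determinant. In the Cramer bound \<open>m - 1\<close> factors \<open>x\<close>
  then cancel, leaving a single \<open>x\<close> on the left.\<close>

lemma Wu_mapping_norm_le:
  fixes F :: "complex ^ 'm \<Rightarrow> complex ^ 'm" and z v :: "complex ^ 'm"
  defines "x \<equiv> norm (det (complex_jacobian F z)) powr (1 / real CARD('m))"
  assumes "Wu_mapping K F" "z \<in> unit_polydisk" "det (complex_jacobian F z) \<noteq> 0"
  shows "x * norm v
    \<le> real CARD('m) * fact CARD('m) * K ^ (CARD('m) - 1) * norm (complex_jacobian F z *v v)"
proof -
  let ?J = "complex_jacobian F z" and ?m = "CARD('m)"
  have "x > 0" using assms by (simp add: x_def)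
  have "norm (det ?J) = x ^ ?m"
    using assms(4) by (simp add: x_def powr_power)
  then have det: "norm (det ?J) = x ^ (?m - 1) * x"
    by (simp only: power_minus_mult[OF zero_less_card_finite])
  have "norm (det ?J) * norm v \<le> real ?m * fact ?m * (K * x) ^ (?m - 1) * norm (?J *v v)"
    by (rule norm_det_mult_norm_le)
      (use Wu_mapping_norm_component_le[OF assms(2,3)] in \<open>simp add: x_def\<close>)
  then have "x ^ (?m - 1) * (x * norm v)
      \<le> x ^ (?m - 1) * (real ?m * fact ?m * K ^ (?m - 1) * norm (?J *v v))"
    by (simp add: det power_mult_distrib mult_ac)
  then show ?thesis
    using \<open>x > 0\<close> by simp
qed

text \<open>At the origin the entries are at most \<open>K\<close>, so
  \<open>1 \<le> m! * K ^ m\<close>. If \<open>m! * K < 1\<close>, then \<open>K < 1\<close> and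
  \<open>K ^ m \<le> K\<close>, which is contradictory.\<close>

lemma Wu_mapping_inverse_fact_le:
  fixes F :: "complex ^ 'm \<Rightarrow> complex ^ 'm"
  assumes "Wu_mapping K F" "K > 0" "norm (det (complex_jacobian F 0)) = 1"
  shows "1 / fact CARD('m) \<le> K"
proof (rule ccontr)
  let ?m = "CARD('m)"
  assume "\<not> 1 / fact ?m \<le> K"
  then have less: "fact ?m * K < 1" by (simp add: field_simps)
  have fact1: "(1 :: real) \<le> fact ?m" by (rule fact_ge_1)
  have "K \<le> fact ?m * K" using mult_right_mono[OF fact1, of K] \<open>K > 0\<close> by simp
  then have "K ^ ?m \<le> K ^ 1"
    using less \<open>K > 0\<close> by (intro power_decreasing) (linarith | simp add: Suc_leI)+
  have "norm (complex_jacobian F 0 $ i $ j) \<le> K" for i j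
    using Wu_mapping_norm_component_le[OF assms(1), of 0 i j] assms(3)
    by (simp add: unit_polydisk_def)
  then have "norm (det (complex_jacobian F 0)) \<le> fact ?m * (\<Prod>j\<in>(UNIV :: 'm set). K)"
    by (rule norm_det_le_prod_column_bounds)
  then have "1 \<le> fact ?m * K ^ ?m" using assms(3) by simp
  also have "\<dots> \<le> fact ?m * K" using \<open>K ^ ?m \<le> K ^ 1\<close> by simp
  finally show False using less by simp
qed

lemma Wu_mapping_covers_schlicht_disk:
  fixes F :: "complex ^ 'm \<Rightarrow> complex ^ 'm"
  defines "m \<equiv> CARD('m)"
  assumes Wu: "Wu_mapping K F" and "K > 0" and one: "norm (det (complex_jacobian F 0)) = 1"
  shows "\<exists>R \<ge> 1 / (2 ^ (m + 6) * real m * fact m * K ^ (m - 1)). covers_schlicht_disk F R"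
proof -
  let ?P = "unit_polydisk :: (complex ^ 'm) set"
  define d where "d z = norm (det (complex_jacobian F z))" for z
  have "m > 0" by (simp add: m_def)
  have F: "holomorphic_map_on F ?P" using Wu by (simp add: Wu_mapping_def)
  have sub: "cball 0 (1/2) \<subseteq> ?P"
    using ball_subset_unit_polydisk by (force simp: subset_iff)
  have contd: "continuous_on (cball 0 (1/2)) d"
    unfolding d_def using continuous_on_det_complex_jacobian[OF F open_unit_polydisk] sub
    by (intro continuous_on_norm) (rule continuous_on_subset)
  \<comment> \<open>The exponent \<open>m\<close> matches the degree of the determinant: the maximum
    becomes \<open>(t * y) ^ m\<close> with \<open>y\<close> the \<open>m\<close>-th root of
    \<open>D\<close>, and comparison with the value at 0 gives
    \<open>t * y \<ge> 1/2\<close>.\<close>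
  define \<phi> where "\<phi> z = (1/2 - norm z) ^ m * d z" for z
  obtain z0 where z0: "z0 \<in> cball 0 (1/2)" "\<And>z. z \<in> cball 0 (1/2) \<Longrightarrow> \<phi> z \<le> \<phi> z0"
    using continuous_attains_sup[of "cball 0 (1/2)" \<phi>] contd
    unfolding \<phi>_def by (force intro: continuous_intros)
  define t D where "t = 1/2 - norm z0" and "D = d z0"
  define y where "y = D powr (1 / real m)"
  have \<phi>0: "(1/2) ^ m \<le> t ^ m * D"
    using z0(2)[of 0] one by (simp add: \<phi>_def t_def D_def d_def)
  then have "t ^ m * D > 0" using less_le_trans[of 0 "(1/2) ^ m :: real"] by simp
  moreover have "t \<ge> 0" "D \<ge> 0" using z0(1) by (simp_all add: t_def D_def d_def)
  moreover from calculation have "t \<noteq> 0" "D \<noteq> 0" using \<open>m > 0\<close> by (auto simp: zero_power)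
  ultimately have "t > 0" "D > 0" by auto
  have y: "y > 0" "y ^ m = D" using \<open>D > 0\<close> \<open>m > 0\<close> by (simp_all add: y_def powr_power)
  have ty: "1/2 \<le> t * y"
  proof (rule ccontr)
    assume "\<not> 1/2 \<le> t * y"
    then have "(t * y) ^ m < (1/2) ^ m"
      using y \<open>t > 0\<close> \<open>m > 0\<close> by (intro power_strict_mono) auto
    then show False using \<phi>0 y by (simp add: power_mult_distrib)
  qed
  \<comment> \<open>On this ball the weight \<open>1/2 - norm z\<close> is at least half of its
    value at \<open>z0\<close>, so maximality costs only the factor \<open>2 ^ m\<close>.\<close>
  have in_cball: "z \<in> cball 0 (1/2)" and d_le: "d z \<le> 2 ^ m * D" if "z \<in> ball z0 (t/2)" for z
  proof -
    have "norm z \<le> norm z0 + dist z0 z"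
      using norm_triangle_ineq2[of z z0] by (simp add: dist_norm norm_minus_commute)
    then have z: "t / 2 \<le> 1/2 - norm z" using that by (simp add: t_def)
    then show "z \<in> cball 0 (1/2)" using \<open>t > 0\<close> by simp
    have "(t/2) ^ m * d z \<le> \<phi> z"
      unfolding \<phi>_def using z \<open>t > 0\<close> by (intro mult_right_mono power_mono) (auto simp: d_def)
    also have "\<dots> \<le> t ^ m * D" using z0(2)[OF \<open>z \<in> cball 0 (1/2)\<close>] by (simp add: \<phi>_def t_def D_def)
    finally show "d z \<le> 2 ^ m * D" using \<open>t > 0\<close> by (simp add: power_divide field_simps)
  qed
  \<comment> \<open>The Schwarz estimate with bound \<open>2 ^ m * D\<close> on radius
    \<open>t/2\<close> allows a change of at most \<open>8 * 2 ^ m * D / t * \<rho>\<close>, which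
    this radius makes equal to \<open>D / 2\<close>.\<close>
  define \<rho> where "\<rho> = t / 2 ^ (m + 4)"
  have "\<rho> > 0" using \<open>t > 0\<close> by (simp add: \<rho>_def)
  have "(2::real) ^ 1 \<le> 2 ^ (m + 4)" by (rule power_increasing) auto
  then have "\<rho> \<le> t / 2" using \<open>t > 0\<close> unfolding \<rho>_def by (intro divide_left_mono) auto
  have half: "D / 2 \<le> d z" if "z \<in> ball z0 \<rho>" for z
  proof (cases "z = z0")
    case True
    then show ?thesis using \<open>D > 0\<close> by (simp add: D_def)
  next
    case False
    define v where "v = z - z0"
    \<comment> \<open>The disk \<open>norm s < r\<close> parametrises the part of the line in
      \<open>ball z0 (t/2)\<close>; \<open>s = 0\<close> is \<open>z0\<close> and
      \<open>s = 1\<close> is \<open>z\<close>.\<close>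
    define r where "r = t / 2 / norm v"
    define h where "h s = det (complex_jacobian F (z0 + s *s v))" for s
    have v: "norm v > 0" "norm v < \<rho>"
      using False that by (auto simp: v_def dist_norm norm_minus_commute)
    have mem: "z0 + s *s v \<in> ball z0 (t/2)" if "s \<in> ball 0 r" for s
      using that v by (simp add: r_def dist_norm norm_scalar_mult_vec field_simps)
    have "h holomorphic_on ball 0 r"
      unfolding h_def
      by (rule holomorphic_on_subset[OF
            holomorphic_on_det_complex_jacobian_along_line[OF F open_unit_polydisk]])
        (use mem in_cball sub in blast)
    moreover have "norm (h s) \<le> 2 ^ m * D" if "s \<in> ball 0 r" for s
      using d_le[OF mem[OF that]] by (simp add: h_def d_def)
    moreover have "0 < 2 ^ m * D" using \<open>D > 0\<close> by simp
    moreover have "1 < r" using v \<open>\<rho> \<le> t / 2\<close> by (simp add: r_def less_divide_eq)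
    then have "(1::complex) \<in> ball 0 r" by simp
    ultimately have "norm (h 1 - h 0) \<le> 4 * (2 ^ m * D) * norm (1::complex) / r"
      by (rule norm_diff_le_of_bounded_holomorphic)
    also have "\<dots> = 8 * 2 ^ m * D / t * norm v" using v \<open>t > 0\<close> by (simp add: r_def)
    also have "\<dots> \<le> 8 * 2 ^ m * D / t * \<rho>"
      using v \<open>t > 0\<close> \<open>D > 0\<close> by (intro mult_left_mono) auto
    also have "\<dots> = D / 2" using \<open>t > 0\<close> by (simp add: \<rho>_def power_add)
    finally have "norm (h 1 - h 0) \<le> D / 2" .
    moreover have "norm (h 1) = d z" "norm (h 0) = D" by (simp_all add: h_def d_def D_def v_def)
    ultimately show ?thesis using norm_triangle_ineq2[of "h 0" "h 1"] by (simp add: norm_minus_commute)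
  qed
  have in_P: "z \<in> ?P" and det_nz: "det (complex_jacobian F z) \<noteq> 0" if "z \<in> ball z0 \<rho>" for z
  proof -
    have "z \<in> ball z0 (t/2)" using that \<open>\<rho> \<le> t / 2\<close> by simp
    then show "z \<in> ?P" using in_cball sub by blast
    show "det (complex_jacobian F z) \<noteq> 0" using half[OF that] \<open>D > 0\<close> by (auto simp: d_def)
  qed
  \<comment> \<open>The factor 2 arises because the \<open>m\<close>-th root of \<open>d z\<close>
    is at least \<open>y / 2\<close>: indeed
    \<open>(y / 2) ^ m \<le> D / 2 \<le> d z\<close>.\<close>
  define M where "M = 2 * (real m * fact m * K ^ (m - 1)) / y"
  have "M > 0" using \<open>K > 0\<close> \<open>m > 0\<close> y by (simp add: M_def)
  have low: "norm v \<le> M * norm (complex_jacobian F z *v v)" if z: "z \<in> ball z0 \<rho>" for z v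
  proof -
    define x where "x = d z powr (1 / real m)"
    have x: "x > 0" "x ^ m = d z"
      using det_nz[OF z] \<open>m > 0\<close> by (simp_all add: x_def d_def powr_power)
    have "y / 2 \<le> x"
    proof (rule ccontr)
      assume "\<not> y / 2 \<le> x"
      then have "x ^ m < (y / 2) ^ m" using x \<open>m > 0\<close> by (intro power_strict_mono) auto
      also have "\<dots> = D / 2 ^ m" using y by (simp add: power_divide)
      also have "\<dots> \<le> D / 2"
        using \<open>D > 0\<close> self_le_power[of "2::real" m] \<open>m > 0\<close> by (intro divide_left_mono) auto
      finally show False using half[OF z] x by simp
    qed
    then have "y / 2 * norm v \<le> x * norm v" by (rule mult_right_mono) simp
    also have "\<dots> \<le> real m * fact m * K ^ (m - 1) * norm (complex_jacobian F z *v v)"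
      using Wu_mapping_norm_le[OF Wu in_P[OF z] det_nz[OF z]] by (simp add: x_def d_def m_def)
    finally show ?thesis using y by (simp add: M_def field_simps)
  qed
  obtain S where S: "open S" "connected S" "z0 \<in> S" "S \<subseteq> ball z0 \<rho>" "inj_on F S"
    "F ` S = ball (F z0) (\<rho> / M)"
    by (rule schlicht_ball_if_derivative_bounded_below[OF \<open>\<rho> > 0\<close> \<open>M > 0\<close>
          has_derivative_complex_jacobian[OF F in_P] low
          locally_injective_if_det_complex_jacobian_nonzero[OF F open_unit_polydisk in_P det_nz]])
  then have "covers_schlicht_disk F (\<rho> / M)"
    unfolding covers_schlicht_disk_def using in_P by (intro exI[of _ S] exI[of _ "F z0"]) auto
  \<comment> \<open>\<open>\<rho>\<close> contributes \<open>2 ^ (m + 4)\<close>, \<open>M\<close>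
    one factor 2, and \<open>t * y \<ge> 1/2\<close> the last.\<close>
  moreover have "1 / (2 ^ (m + 6) * real m * fact m * K ^ (m - 1)) \<le> \<rho> / M"
  proof -
    define c where "c = real m * fact m * K ^ (m - 1)"
    have "c > 0" using \<open>K > 0\<close> \<open>m > 0\<close> by (simp add: c_def)
    have "\<rho> / M = t * y / (2 ^ (m + 5) * c)"
      using y by (simp add: \<rho>_def M_def c_def power_add)
    also have "\<dots> \<ge> (1/2) / (2 ^ (m + 5) * c)"
      using ty \<open>c > 0\<close> by (intro divide_right_mono) auto
    finally show ?thesis by (simp add: c_def power_add mult_ac)
  qed
  ultimately show ?thesis by blast
qed

theorem theorem5p1:
  "\<exists>C::real. C > 0 \<and>
     (\<forall>K>0. \<forall>F :: complex ^ 'm \<Rightarrow> complex ^ 'm.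
        Wu_mapping K F \<and> norm (det (complex_jacobian F 0)) = 1 \<longrightarrow>
        (\<exists>R \<ge> C / K powr (3 / 2 * real CARD('m) - 1 / 2). covers_schlicht_disk F R))"
proof -
  define m where "m = CARD('m)"
  define a :: real where "a = 2 ^ (m + 6) * real m * fact m"
  \<comment> \<open>The asserted exponent exceeds \<open>m - 1\<close> by
    \<open>(m + 1) / 2\<close>. Since \<open>K \<ge> 1 / m!\<close>, this surplus power of
    \<open>K\<close> is at least \<open>b\<close>, so the constant \<open>b / a\<close> absorbs
    it.\<close>
  define b :: real where "b = (1 / fact m) powr ((real m + 1) / 2)"
  have "m > 0" by (simp add: m_def)
  then have "a > 0" "b > 0" by (simp_all add: a_def b_def)
  have "\<exists>R \<ge> b / a / K powr (3 / 2 * real m - 1 / 2). covers_schlicht_disk F R"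
    if K: "K > 0" and F: "Wu_mapping K F" "norm (det (complex_jacobian F 0)) = 1"
    for K and F :: "complex ^ 'm \<Rightarrow> complex ^ 'm"
  proof -
    have "b \<le> K powr ((real m + 1) / 2)"
      unfolding b_def m_def using Wu_mapping_inverse_fact_le[OF F(1) K F(2)]
      by (intro powr_mono2) auto
    moreover have "K powr (3 / 2 * real m - 1 / 2) = K ^ (m - 1) * K powr ((real m + 1) / 2)"
    proof -
      have "3 / 2 * real m - 1 / 2 = real (m - 1) + (real m + 1) / 2"
        using \<open>m > 0\<close> by (simp add: of_nat_diff field_simps)
      then show ?thesis using K by (simp add: powr_add powr_realpow)
    qed
    ultimately have "b / a / K powr (3 / 2 * real m - 1 / 2) \<le> 1 / (a * K ^ (m - 1))"
      using \<open>a > 0\<close> \<open>b > 0\<close> K by (simp add: divide_simps)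
    moreover obtain R where "1 / (a * K ^ (m - 1)) \<le> R" "covers_schlicht_disk F R"
      using Wu_mapping_covers_schlicht_disk[OF F(1) K F(2)] unfolding a_def m_def by blast
    ultimately show ?thesis using order_trans by blast
  qed
  then show ?thesis
    using \<open>a > 0\<close> \<open>b > 0\<close> unfolding m_def by (intro exI[of _ "b / a"]) auto
qed

end
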